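(* Let $G$ be a finite simple undirected graph and let $n\ge 3$ be an integer. Then $$\kappa(G\times K_n)=\min\{\,n\,\kappa(G),\ (n-1)\,\delta(G)\,\}.$$
   Context: All graphs are finite, undirected, without loops or multiple edges (and have at least one vertex). $K_n$ denotes the complete graph on $n$ vertices. $\delta(G)$ denotes the minimum degree of $G$. The connectivity $\kappa(G)$ is the fewest number of vertices whose removal from $G$ results in a disconnected graph or a trivial (one-vertex) graph; in particular $\kappa(G)=0$ if $G$ is disconnected or has exactly one vertex, and $\kappa(K_m)=m-1$. The direct (Kronecker) product $G\times H$ of graphs $G$ and $H$ has vertex set $V(G)\times V(H)$ and edge set $\{(u_1,v_1)(u_2,v_2): u_1u_2\in E(G)\text{ and }v_1v_2\in E(H)\}$. *)

theory Defs
  imports "Graph_Theory.Graph_Theory"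
begin

text \<open>
  A finite simple undirected graph is represented as a \<^locale>\<open>pair_graph\<close>: a finite, loop-free,
  symmetric set of vertex pairs, each undirected edge \<open>uv\<close> being the two arcs \<open>(u, v)\<close> and
  \<open>(v, u)\<close>. The locale allows the empty vertex set, so \<open>pverts G \<noteq> {}\<close> is to be assumed
  separately.
\<close>

definition direct_product ::
    "'a pair_pre_digraph \<Rightarrow> 'b pair_pre_digraph \<Rightarrow> ('a \<times> 'b) pair_pre_digraph" where
  "direct_product G H =
    \<lparr> pverts = pverts G \<times> pverts H,
      parcs = {((u1, v1), (u2, v2)) | u1 v1 u2 v2. (u1, u2) \<in> parcs G \<and> (v1, v2) \<in> parcs H} \<rparr>"

text \<open>Both arcs of an undirected edge are present, so \<^const>\<open>out_degree\<close> is the ordinary degree.\<close>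

definition min_degree :: "('a, 'b) pre_digraph \<Rightarrow> nat" where
  "min_degree G = Min (out_degree G ` verts G)"

text \<open>
  Only proper subsets are removed, since graphs have at least one vertex
  (\<^const>\<open>connected\<close> is false for the graph without vertices).
\<close>

definition disconnects_or_trivializes :: "('a, 'b) pre_digraph \<Rightarrow> 'a set \<Rightarrow> bool" where
  "disconnects_or_trivializes G S \<longleftrightarrow> S \<subset> verts G \<and>
    (\<not> connected (G \<restriction> (verts G - S)) \<or> card (verts G - S) = 1)"

definition vertex_connectivity :: "('a, 'b) pre_digraph \<Rightarrow> nat" where
  "vertex_connectivity G = (LEAST k. \<exists>S. disconnects_or_trivializes G S \<and> card S = k)"

lemma pair_graph_direct_product:
  assumes "pair_graph G" and "pair_graph H"
  shows "pair_graph (direct_product G H)"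
proof -
  interpret G: pair_graph G by fact
  interpret H: pair_graph H by fact
  have "parcs (direct_product G H) \<subseteq> (pverts G \<times> pverts H) \<times> (pverts G \<times> pverts H)"
    by (auto simp: direct_product_def dest: G.in_arcsD1 G.in_arcsD2 H.in_arcsD1 H.in_arcsD2)
  then have "finite (parcs (direct_product G H))"
    by (rule finite_subset) (simp add: G.pair_finite_verts H.pair_finite_verts)
  then show ?thesis
    by unfold_locales
      (auto simp: direct_product_def symmetric_def sym_def G.pair_finite_verts H.pair_finite_verts
        dest: G.in_arcsD1 G.in_arcsD2 H.in_arcsD1 H.in_arcsD2 G.no_loops'
          G.arcs_symmetric H.arcs_symmetric)
qed

lemma vertex_connectivity_eq_0_iff:
  assumes "finite (verts G)" and "verts G \<noteq> {}" and "wf_digraph G"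
  shows "vertex_connectivity G = 0 \<longleftrightarrow> \<not> connected G \<or> card (verts G) = 1"
proof -
  interpret wf_digraph G by fact
  obtain x where x: "x \<in> verts G" using assms by auto
  have "disconnects_or_trivializes G (verts G - {x})"
    using x by (auto simp: disconnects_or_trivializes_def double_diff)
  then have "\<exists>k S. disconnects_or_trivializes G S \<and> card S = k" by blast
  then have "\<exists>S. disconnects_or_trivializes G S \<and> card S = vertex_connectivity G"
    unfolding vertex_connectivity_def by (rule LeastI_ex)
  then obtain S where S: "disconnects_or_trivializes G S" "card S = vertex_connectivity G" by blast
  have 1: "G \<restriction> verts G = G"
    unfolding induce_subgraph_def by (rule pre_digraph.equality) auto
  have 2: "disconnects_or_trivializes G {} \<longleftrightarrow> \<not> connected G \<or> card (verts G) = 1"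
    using assms(2) by (auto simp: disconnects_or_trivializes_def 1)
  have fin: "finite S"
    using S(1) assms(1) by (auto simp: disconnects_or_trivializes_def dest: psubset_imp_subset finite_subset)
  show ?thesis
  proof
    assume "vertex_connectivity G = 0"
    then have "S = {}" using S(2) fin by simp
    then show "\<not> connected G \<or> card (verts G) = 1" using S(1) 2 by simp
  next
    assume "\<not> connected G \<or> card (verts G) = 1"
    then have "disconnects_or_trivializes G {}" using 2 by simp
    then show "vertex_connectivity G = 0"
      unfolding vertex_connectivity_def by (intro Least_eq_0) (auto intro: exI[of _ "{}"])
  qed
qed

lemma vertex_connectivity_complete:
  assumes "complete_digraph n (with_proj G)" and "n \<ge> 1"
  shows "vertex_connectivity (with_proj G) = n - 1"
proof -
  have G: "finite (pverts G)" "card (pverts G) = n"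
      "parcs G = {(u, v). (u, v) \<in> pverts G \<times> pverts G \<and> u \<noteq> v}"
    using assms(1) by (simp_all add: complete_digraph_pair_def)
  have conn: "connected (with_proj G \<restriction> (pverts G - S))" if "S \<subset> pverts G" for S
  proof -
    let ?M = "with_proj (mk_symmetric (with_proj G \<restriction> (pverts G - S)))"
    have arcs: "parcs (mk_symmetric (with_proj G \<restriction> (pverts G - S))) =
        {(u, v). u \<in> pverts G - S \<and> v \<in> pverts G - S \<and> u \<noteq> v}"
      by (auto simp: mk_symmetric_def G(3))
    have verts: "pverts (mk_symmetric (with_proj G \<restriction> (pverts G - S))) = pverts G - S"
      by (simp add: mk_symmetric_def)
    have "strongly_connected ?M"
    proof
      show "verts ?M \<noteq> {}" using that by (auto simp: mk_symmetric_def)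
      fix u v assume "u \<in> verts ?M" "v \<in> verts ?M"
      then have uv: "u \<in> pverts G - S" "v \<in> pverts G - S" by (auto simp: mk_symmetric_def)
      have wf: "wf_digraph ?M"
        by (rule wf_digraph.intro) (auto simp: arcs verts)
      show "u \<rightarrow>\<^sup>*\<^bsub>?M\<^esub> v"
      proof (cases "u = v")
        case True
        then show ?thesis using uv wf by (auto simp: mk_symmetric_def intro!: wf_digraph.reachable_refl)
      next
        case False
        then have "u \<rightarrow>\<^bsub>?M\<^esub> v" using uv by (auto simp: arcs)
        then show ?thesis using wf by (rule wf_digraph.reachable_adjI[rotated])
      qed
    qed
    then show ?thesis by (simp add: connected_def)
  qed
  have iff: "disconnects_or_trivializes (with_proj G) S \<longleftrightarrow> S \<subset> pverts G \<and> card S = n - 1" for S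
  proof (cases "S \<subset> pverts G")
    case True
    have "card S < n"
      using psubset_card_mono[OF G(1) True] G(2) by simp
    moreover have "card (pverts G - S) = n - card S"
      using True G(1,2) by (auto simp: card_Diff_subset finite_subset)
    ultimately show ?thesis using True conn[OF True] by (auto simp: disconnects_or_trivializes_def)
  qed (simp add: disconnects_or_trivializes_def)
  obtain x where x: "x \<in> pverts G" using G(2) assms(2) by fastforce
  then have "pverts G - {x} \<subset> pverts G \<and> card (pverts G - {x}) = n - 1"
    using G(1,2) by auto
  then show ?thesis
    unfolding vertex_connectivity_def iff by (intro Least_equality) auto
qed

end

theory Submission
  imports Defs
begin

text \<open>
  Write \<open>\<kappa>\<close> and \<open>\<delta>\<close> for the connectivity and the minimum degree of \<open>G\<close>. Both numbers on the right
  are attained by obvious cuts of the product: a minimum cut of \<open>G\<close> times all of \<open>K\<close>, and the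
  neighbourhood of a vertex \<open>(u, b)\<close> with \<open>u\<close> of minimum degree.

  For the lower bound, let the removal of a set leave two nonempty parts \<open>X\<close> and \<open>Y\<close> with no edge
  between them, and cut everything into the fibres over the vertices of \<open>G\<close>. Two vertices over
  adjacent \<open>u\<close>, \<open>w\<close> are adjacent unless their second coordinates agree. So if \<open>X\<close> meets the fibre of
  \<open>u\<close> and \<open>Y\<close> that of \<open>w\<close>, then both intersections consist of one and the same element of \<open>K\<close>
  (\<open>adjacent_eq_singleton\<close>). This makes the removed set large near every place where \<open>X\<close> and \<open>Y\<close> come
  close to each other. Call \<open>u\<close> mixed if its fibre meets both parts.

  \<^item> A mixed vertex without mixed neighbours has only neighbours that lose at least \<open>n - 1\<close>
    vertices of their fibre, which gives \<open>(n - 1) * \<delta>\<close>.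
  \<^item> If \<open>u\<close> and \<open>w\<close> are adjacent and both mixed, then every neighbour of either loses at least
    \<open>n - 2\<close> vertices and every common neighbour its whole fibre. Since \<open>2 * (n - 2) \<ge> n - 1\<close>, the two
    neighbourhoods together again account for \<open>(n - 1) * \<delta>\<close> (\<open>mixed_edge_bound\<close>).
  \<^item> Without mixed vertices, the vertices of \<open>G\<close> split into those with an empty fibre, the \<open>X\<close>-vertices
    and the \<open>Y\<close>-vertices. The boundary of each side, that is its vertices with a neighbour on the
    other side, loses exactly \<open>n - 1\<close> per vertex. If one side is all boundary, then all neighbours
    of any of its vertices lose at least \<open>n - 1\<close>, which yields \<open>(n - 1) * \<delta>\<close>
    (\<open>unmixed_degree_bound\<close>). Otherwise the vertices with an empty fibre together with either
    boundary separate \<open>G\<close> (\<open>boundary_separation\<close>). If the number \<open>t\<close> of empty fibres is at least \<open>\<kappa>\<close>,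
    these alone give \<open>n * \<kappa>\<close>; if not, each boundary has at least \<open>\<kappa> - t\<close> vertices, and the loss is
    at least \<open>n * t + 2 * (n - 1) * (\<kappa> - t) \<ge> n * \<kappa>\<close>.
\<close>

section \<open>Separations and vertex connectivity\<close>

text \<open>The parts need not be connected: they are unions of components of what remains.\<close>

definition separation :: "'a pair_pre_digraph \<Rightarrow> 'a set \<Rightarrow> 'a set \<Rightarrow> 'a set \<Rightarrow> bool" where
  "separation G S X Y \<longleftrightarrow> pverts G = S \<union> X \<union> Y \<and> S \<inter> X = {} \<and> S \<inter> Y = {} \<and> X \<inter> Y = {} \<and>
    X \<noteq> {} \<and> Y \<noteq> {} \<and> (\<forall>x\<in>X. \<forall>y\<in>Y. (x, y) \<notin> parcs G)"

text \<open>
  For one direction, the vertices reachable from \<open>u\<close> and the remaining ones form the two parts if some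
  vertex is unreachable from \<open>u\<close>; for the other, no walk leaves the part in which it starts.
\<close>

lemma (in pair_graph) not_connected_induce_iff_separation:
  assumes "S \<subset> pverts G"
  shows "\<not> connected (with_proj G \<restriction> (pverts G - S)) \<longleftrightarrow> (\<exists>X Y. separation G S X Y)"
proof -
  let ?W = "pverts G - S"
  let ?R = "{(u, v). (u, v) \<in> parcs G \<and> u \<in> ?W \<and> v \<in> ?W}"
  have "arcs_ends (with_proj G \<restriction> ?W) = ?R"
    by (auto simp: arcs_ends_conv image_iff)
  moreover have "?R\<^sup>s = ?R"
    by (auto simp: symcl_def dest: arcs_symmetric)
  ultimately have conn: "connected (with_proj G \<restriction> ?W) \<longleftrightarrow>
      (\<forall>u\<in>?W. \<forall>v\<in>?W. (u, v) \<in> rtrancl_on ?W ?R)"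
    using assms by (auto simp: connected_conv)
  show ?thesis
  proof
    assume "\<not> connected (with_proj G \<restriction> ?W)"
    then obtain u v where uv: "u \<in> ?W" "v \<in> ?W" "(u, v) \<notin> rtrancl_on ?W ?R"
      using conn by auto
    define X where "X = {x \<in> ?W. (u, x) \<in> rtrancl_on ?W ?R}"
    have "u \<in> X" "v \<in> ?W - X"
      using uv by (auto simp: X_def)
    moreover have "(x, y) \<notin> parcs G" if "x \<in> X" "y \<in> ?W - X" for x y
    proof
      assume "(x, y) \<in> parcs G"
      then have "(u, y) \<in> rtrancl_on ?W ?R"
        using that by (auto simp: X_def intro: rtrancl_on_into_rtrancl_on)
      then show False
        using that by (auto simp: X_def)
    qed
    moreover have "X \<subseteq> ?W"
      by (auto simp: X_def)
    ultimately have "separation G S X (?W - X)"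
      using assms by (auto simp: separation_def)
    then show "\<exists>X Y. separation G S X Y" by blast
  next
    assume "\<exists>X Y. separation G S X Y"
    then obtain X Y where XY: "separation G S X Y" by blast
    then obtain x y where "x \<in> X" "y \<in> Y"
      by (auto simp: separation_def)
    then have xy: "x \<in> X" "x \<in> ?W" "y \<in> ?W" "y \<notin> X"
      using XY by (auto simp: separation_def)
    have "v \<in> X" if "(x, v) \<in> rtrancl_on ?W ?R" for v
      using that
    proof (induction rule: rtrancl_on_induct)
      case base
      then show ?case using xy by simp
    next
      case (step v w)
      then show ?case using XY by (auto simp: separation_def)
    qed
    then show "\<not> connected (with_proj G \<restriction> ?W)"
      using conn xy by blast
  qed
qed

lemma (in pair_graph) vertex_connectivity_le_separation:
  assumes "separation G S X Y"
  shows "vertex_connectivity (with_proj G) \<le> card S"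
proof -
  have S: "S \<subset> pverts G"
    using assms by (auto simp: separation_def)
  then have "disconnects_or_trivializes (with_proj G) S"
    using not_connected_induce_iff_separation[OF S] assms
    by (auto simp: disconnects_or_trivializes_def)
  then show ?thesis
    unfolding vertex_connectivity_def by (intro Least_le) blast
qed

text \<open>The second alternative is needed for complete graphs, which have no separation.\<close>

lemma (in pair_graph) vertex_connectivity_attained:
  assumes "pverts G \<noteq> {}"
  obtains S X Y where "separation G S X Y" "vertex_connectivity (with_proj G) = card S"
  | x where "x \<in> pverts G" "vertex_connectivity (with_proj G) = card (pverts G - {x})"
proof -
  obtain x where "x \<in> pverts G"
    using assms by auto
  then have "disconnects_or_trivializes (with_proj G) (pverts G - {x})"
    by (auto simp: disconnects_or_trivializes_def double_diff)
  then have "\<exists>k S. disconnects_or_trivializes (with_proj G) S \<and> card S = k"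
    by blast
  then have "\<exists>S. disconnects_or_trivializes (with_proj G) S \<and>
      card S = vertex_connectivity (with_proj G)"
    unfolding vertex_connectivity_def by (rule LeastI_ex)
  then obtain S where S: "disconnects_or_trivializes (with_proj G) S"
      "card S = vertex_connectivity (with_proj G)"
    by blast
  then have sub: "S \<subset> pverts G"
    by (simp add: disconnects_or_trivializes_def)
  consider "\<not> connected (with_proj G \<restriction> (pverts G - S))" | "card (pverts G - S) = 1"
    using S(1) by (auto simp: disconnects_or_trivializes_def)
  then show ?thesis
  proof cases
    case 1
    then show ?thesis
      using not_connected_induce_iff_separation[OF sub] S(2) that(1) by metis
  next
    case 2
    then obtain y where "pverts G - S = {y}"
      by (auto simp: card_1_singleton_iff)
    then have "y \<in> pverts G" "S = pverts G - {y}"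
      using sub by auto
    then show ?thesis
      using S(2) that(2) by metis
  qed
qed

lemma out_degree_with_proj: "out_degree (with_proj G) u = card (parcs G `` {u})"
proof -
  have "out_arcs (with_proj G) u = Pair u ` (parcs G `` {u})"
    by (auto simp: out_arcs_def)
  then show ?thesis
    by (simp add: out_degree_def card_image inj_on_def)
qed

lemma (in pair_graph) min_degree_le:
  assumes "u \<in> pverts G"
  shows "min_degree (with_proj G) \<le> card (parcs G `` {u})"
  using assms pair_finite_verts
  by (auto simp: min_degree_def out_degree_with_proj[symmetric] intro!: Min_le)

lemma (in pair_graph) min_degree_attained:
  assumes "pverts G \<noteq> {}"
  obtains u where "u \<in> pverts G" "min_degree (with_proj G) = card (parcs G `` {u})"
proof -
  have "Min (out_degree (with_proj G) ` pverts G) \<in> out_degree (with_proj G) ` pverts G"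
    using assms pair_finite_verts by (intro Min_in) auto
  then show ?thesis
    using that by (auto simp: min_degree_def out_degree_with_proj)
qed

lemma (in pair_graph) neighbours_subset: "parcs G `` {u} \<subseteq> pverts G"
  by (auto dest: in_arcsD2)


section \<open>Separations of the product, fibre by fibre\<close>

text \<open>
  A separation of the product of \<open>G\<close> with the complete graph on \<open>B\<close>, given by its fibres: \<open>S u\<close> is the
  removed part of the fibre over \<open>u\<close>, and \<open>X u\<close>, \<open>Y u\<close> are what the two sides contain of it. The
  assumptions are symmetric in \<open>X\<close> and \<open>Y\<close>, so every result below comes with its mirror image.
\<close>

locale fibred_separation = pair_graph G for G :: "'a pair_pre_digraph" +
  fixes B :: "'b set" and S X Y :: "'a \<Rightarrow> 'b set"
  assumes finite_B: "finite B" and card_B: "3 \<le> card B"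
    and fibre: "u \<in> pverts G \<Longrightarrow> B = S u \<union> X u \<union> Y u"
    and disjoint: "u \<in> pverts G \<Longrightarrow> S u \<inter> X u = {} \<and> S u \<inter> Y u = {} \<and> X u \<inter> Y u = {}"
    and nonempty_X: "\<exists>u\<in>pverts G. X u \<noteq> {}"
    and nonempty_Y: "\<exists>u\<in>pverts G. Y u \<noteq> {}"
    and separated: "(u, w) \<in> parcs G \<Longrightarrow> a \<in> X u \<Longrightarrow> b \<in> Y w \<Longrightarrow> a = b"
begin

lemma swap: "fibred_separation G B S Y X"
proof unfold_locales
  show "a = b" if "(u, w) \<in> parcs G" "a \<in> Y u" "b \<in> X w" for u w a b
    using that separated[of w u b a] arcs_symmetric by auto
next
  show "B = S u \<union> Y u \<union> X u" if "u \<in> pverts G" for u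
    using fibre[OF that] by blast
next
  show "S u \<inter> Y u = {} \<and> S u \<inter> X u = {} \<and> Y u \<inter> X u = {}" if "u \<in> pverts G" for u
    using disjoint[OF that] by blast
qed (fact finite_B card_B nonempty_X nonempty_Y)+

lemma card_fibre:
  assumes "u \<in> pverts G"
  shows "card (S u) + card (X u) + card (Y u) = card B"
proof -
  have "finite (S u)" "finite (X u)" "finite (Y u)"
    using finite_B fibre[OF assms] by (metis finite_Un)+
  then show ?thesis
    using disjoint[OF assms] fibre[OF assms] by (simp add: card_Un_disjoint Int_Un_distrib2)
qed

lemma removed_fibres_eq: "{u \<in> pverts G. S u = B} = {u \<in> pverts G. X u = {} \<and> Y u = {}}"
  using fibre disjoint by blast

text \<open>
  The principle behind all bounds: any \<open>a \<in> X u\<close> and \<open>b \<in> Y w\<close> must coincide, which leaves room for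
  one element only.
\<close>

lemma adjacent_eq_singleton:
  assumes "(u, w) \<in> parcs G" "X u \<noteq> {}" "Y w \<noteq> {}"
  obtains a where "X u = {a}" "Y w = {a}"
  using assms separated by blast

lemma degree_bound:
  assumes "u \<in> pverts G" "\<And>w. (u, w) \<in> parcs G \<Longrightarrow> card B - 1 \<le> card (S w)"
  shows "(card B - 1) * min_degree (with_proj G) \<le> (\<Sum>w\<in>pverts G. card (S w))"
proof -
  have "(card B - 1) * min_degree (with_proj G) \<le> (card B - 1) * card (parcs G `` {u})"
    using min_degree_le[OF assms(1)] by (rule mult_le_mono2)
  also have "\<dots> = (\<Sum>w\<in>parcs G `` {u}. card B - 1)"
    by simp
  also have "\<dots> \<le> (\<Sum>w\<in>parcs G `` {u}. card (S w))"
    using assms(2) by (intro sum_mono) auto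
  also have "\<dots> \<le> (\<Sum>w\<in>pverts G. card (S w))"
    using neighbours_subset pair_finite_verts by (intro sum_mono2) auto
  finally show ?thesis .
qed

definition mixed :: "'a \<Rightarrow> bool" where
  "mixed u \<longleftrightarrow> X u \<noteq> {} \<and> Y u \<noteq> {}"

text \<open>
  Whichever side survives over \<open>w\<close> faces the opposite side over \<open>u\<close>, so at most one vertex survives.
\<close>

lemma unmixed_neighbour_of_mixed:
  assumes "mixed u" "(u, w) \<in> parcs G" "\<not> mixed w"
  shows "card B - 1 \<le> card (S w)"
proof -
  have w: "w \<in> pverts G" using assms(2) by (rule in_arcsD2)
  interpret sw: fibred_separation G B S Y X by (rule swap)
  consider "X w = {}" "Y w = {}" | a where "X w = {}" "Y w = {a}" | a where "X w = {a}" "Y w = {}"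
    using assms adjacent_eq_singleton[of u w] sw.adjacent_eq_singleton[of u w]
    unfolding mixed_def by metis
  then show ?thesis
    using card_fibre[OF w] by cases simp_all
qed

text \<open>
  A mixed neighbour may lose only \<open>n - 2\<close> vertices, so one neighbourhood does not suffice. Two adjacent
  mixed vertices carry the same two labels \<open>a \<noteq> b\<close> with the sides exchanged. Near \<open>u\<close> the side \<open>X\<close> can
  only keep \<open>b\<close>, near \<open>w\<close> only \<open>a\<close>, and conversely for \<open>Y\<close>; hence nothing survives over common
  neighbours, and the two neighbourhoods can be counted together without loss.
\<close>

lemma mixed_edge_bound:
  assumes "mixed u" "mixed w" "(u, w) \<in> parcs G"
  shows "(card B - 1) * min_degree (with_proj G) \<le> (\<Sum>v\<in>pverts G. card (S v))"
proof -
  interpret sw: fibred_separation G B S Y X by (rule swap)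
  let ?n = "card B"
  let ?N = "\<lambda>u. parcs G `` {u}"
  have u: "u \<in> pverts G" and w: "w \<in> pverts G"
    using assms(3) by (auto dest: in_arcsD1 in_arcsD2)
  obtain a where a: "X u = {a}" "Y w = {a}"
    using assms adjacent_eq_singleton[of u w] unfolding mixed_def by metis
  obtain b where b: "Y u = {b}" "X w = {b}"
    using assms sw.adjacent_eq_singleton[of u w] unfolding mixed_def by metis
  have ab: "a \<noteq> b"
    using disjoint[OF u] a b by auto
  have near_u: "X v \<subseteq> {b}" "Y v \<subseteq> {a}" if "v \<in> ?N u" for v
    using that a b separated[of u v a] sw.separated[of u v b] by blast+
  have near_w: "X v \<subseteq> {a}" "Y v \<subseteq> {b}" if "v \<in> ?N w" for v
    using that a b separated[of w v b] sw.separated[of w v a] by blast+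
  have common: "card (S v) = ?n" if v: "v \<in> ?N u" "v \<in> ?N w" for v
  proof -
    have "X v = {}" "Y v = {}"
      using near_u[OF v(1)] near_w[OF v(2)] ab by blast+
    then show ?thesis
      using card_fibre[of v] neighbours_subset v by auto
  qed
  have single: "?n - 2 \<le> card (S v)" if v: "v \<in> ?N u \<union> ?N w" for v
  proof -
    have "X v \<subseteq> {a} \<or> X v \<subseteq> {b}" "Y v \<subseteq> {a} \<or> Y v \<subseteq> {b}"
      using v near_u near_w by blast+
    then have "card (X v) \<le> 1" "card (Y v) \<le> 1"
      by (auto simp: subset_singleton_iff)
    moreover have "v \<in> pverts G"
      using v neighbours_subset by blast
    ultimately show ?thesis
      using card_fibre[of v] by simp
  qed
  \<comment> \<open>Here \<open>n \<ge> 3\<close> enters: \<open>n - 1 \<le> 2 * (n - 2)\<close>.\<close>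
  have pointwise: "(?n - 1) * (of_bool (v \<in> ?N u) + of_bool (v \<in> ?N w)) \<le> 2 * card (S v)" for v
    using common[of v] single[of v] card_B by (cases "v \<in> ?N u"; cases "v \<in> ?N w") auto
  have deg: "(\<Sum>v\<in>pverts G. of_bool (v \<in> ?N x)) = card (?N x)" for x
    using pair_finite_verts neighbours_subset[of x]
    by (simp add: Int_absorb1 Image_singleton[symmetric] del: Image_singleton_iff)
  have "2 * ((?n - 1) * min_degree (with_proj G)) \<le> (?n - 1) * (card (?N u) + card (?N w))"
    using min_degree_le[OF u] min_degree_le[OF w]
    by (metis add_mono mult.left_commute mult_2 mult_le_mono2)
  also have "\<dots> = (\<Sum>v\<in>pverts G. (?n - 1) * (of_bool (v \<in> ?N u) + of_bool (v \<in> ?N w)))"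
    by (simp only: deg sum.distrib sum_distrib_left[symmetric])
  also have "\<dots> \<le> (\<Sum>v\<in>pverts G. 2 * card (S v))"
    using pointwise by (intro sum_mono)
  finally show ?thesis
    by (simp add: sum_distrib_left[symmetric])
qed

lemma mixed_bound:
  assumes "u \<in> pverts G" "mixed u"
  shows "(card B - 1) * min_degree (with_proj G) \<le> (\<Sum>v\<in>pverts G. card (S v))"
  using assms degree_bound[of u] mixed_edge_bound unmixed_neighbour_of_mixed by metis

text \<open>
  The boundary of the side \<open>X\<close> towards \<open>Y\<close>. Interpreting the locale with the sides exchanged yields the
  boundary of \<open>Y\<close> towards \<open>X\<close>.
\<close>

definition boundary :: "'a set" where
  "boundary = {u \<in> pverts G. X u \<noteq> {} \<and> (\<exists>w. (u, w) \<in> parcs G \<and> Y w \<noteq> {})}"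

lemma boundary_loss:
  assumes "u \<in> boundary" "\<not> mixed u"
  shows "card (S u) = card B - 1"
proof -
  obtain a where "X u = {a}"
    using assms(1) adjacent_eq_singleton unfolding boundary_def by blast
  then show ?thesis
    using card_fibre[of u] assms by (auto simp: boundary_def mixed_def)
qed

text \<open>
  Every edge of \<open>G\<close> between the two sides starts in the boundary of \<open>X\<close>, so deleting this boundary and
  the vertices with an empty fibre cuts the rest of the side \<open>X\<close> off from \<open>Y\<close>.
\<close>

lemma boundary_separation:
  assumes "\<And>u. u \<in> pverts G \<Longrightarrow> \<not> mixed u" "\<not> {u \<in> pverts G. X u \<noteq> {}} \<subseteq> boundary"
  shows "separation G ({u \<in> pverts G. S u = B} \<union> boundary)
    ({u \<in> pverts G. X u \<noteq> {}} - boundary) {u \<in> pverts G. Y u \<noteq> {}}"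
proof -
  define T P Q where sets: "T = {u \<in> pverts G. X u = {} \<and> Y u = {}}"
    "P = {u \<in> pverts G. X u \<noteq> {}}" "Q = {u \<in> pverts G. Y u \<noteq> {}}"
  have 1: "P \<inter> Q = {}" "boundary \<subseteq> P"
    using assms(1) by (auto simp: mixed_def boundary_def sets)
  have 2: "pverts G = T \<union> P \<union> Q" "T \<inter> P = {}" "T \<inter> Q = {}"
    by (auto simp: sets)
  have 3: "\<forall>x\<in>P - boundary. \<forall>y\<in>Q. (x, y) \<notin> parcs G"
    unfolding boundary_def sets by blast
  have 4: "P - boundary \<noteq> {}" "Q \<noteq> {}"
    using assms(2) nonempty_Y by (auto simp: sets)
  have "separation G (T \<union> boundary) (P - boundary) Q"
    unfolding separation_def using 1 2(2,3) 3 4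
    by (intro conjI) (simp_all add: 2(1), blast+)
  then show ?thesis
    by (simp only: sets removed_fibres_eq)
qed

text \<open>
  Over a neighbour of an \<open>X\<close>-vertex, either nothing survives, or the neighbour is an \<open>X\<close>-vertex and hence
  in the boundary by assumption, or it is a \<open>Y\<close>-vertex and hence in the opposite boundary.
\<close>

lemma unmixed_degree_bound:
  assumes "\<And>u. u \<in> pverts G \<Longrightarrow> \<not> mixed u" "{u \<in> pverts G. X u \<noteq> {}} \<subseteq> boundary"
  shows "(card B - 1) * min_degree (with_proj G) \<le> (\<Sum>v\<in>pverts G. card (S v))"
proof -
  interpret sw: fibred_separation G B S Y X by (rule swap)
  have sw_mixed: "sw.mixed = mixed"
    by (auto simp: fun_eq_iff mixed_def sw.mixed_def)
  obtain u where u: "u \<in> pverts G" "X u \<noteq> {}"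
    using nonempty_X by blast
  show ?thesis
  proof (rule degree_bound[OF u(1)])
    fix w assume w: "(u, w) \<in> parcs G"
    then have wV: "w \<in> pverts G" by (rule in_arcsD2)
    consider "w \<in> boundary" | "w \<in> sw.boundary" | "X w = {}" "Y w = {}"
      using assms(2) u w wV arcs_symmetric[OF w] by (auto simp: sw.boundary_def)
    then show "card B - 1 \<le> card (S w)"
      using boundary_loss sw.boundary_loss card_fibre[OF wV] assms(1)[OF wV]
      by cases (auto simp: sw_mixed)
  qed
qed

theorem lower_bound:
  "min (card B * vertex_connectivity (with_proj G)) ((card B - 1) * min_degree (with_proj G))
    \<le> (\<Sum>v\<in>pverts G. card (S v))"
proof -
  interpret sw: fibred_separation G B S Y X by (rule swap)
  have sw_mixed: "sw.mixed = mixed"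
    by (auto simp: fun_eq_iff mixed_def sw.mixed_def)
  let ?n = "card B" and ?k = "vertex_connectivity (with_proj G)"
  let ?T = "{u \<in> pverts G. S u = B}"
  consider u where "u \<in> pverts G" "mixed u"
    | "\<forall>u\<in>pverts G. \<not> mixed u" "{u \<in> pverts G. X u \<noteq> {}} \<subseteq> boundary"
    | "\<forall>u\<in>pverts G. \<not> mixed u" "{u \<in> pverts G. Y u \<noteq> {}} \<subseteq> sw.boundary"
    | "\<forall>u\<in>pverts G. \<not> mixed u" "\<not> {u \<in> pverts G. X u \<noteq> {}} \<subseteq> boundary"
      "\<not> {u \<in> pverts G. Y u \<noteq> {}} \<subseteq> sw.boundary"
    by blast
  then show ?thesis
  proof cases
    case 1
    then show ?thesis using mixed_bound by (simp add: min.coboundedI2)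
  next
    case 2
    then show ?thesis using unmixed_degree_bound by (simp add: min.coboundedI2)
  next
    case 3
    then show ?thesis using sw.unmixed_degree_bound by (simp add: sw_mixed min.coboundedI2)
  next
    case 4
    have fin: "finite ?T" "finite boundary" "finite sw.boundary"
      using pair_finite_verts by (auto simp: boundary_def sw.boundary_def)
    have disj: "?T \<inter> boundary = {}" "?T \<inter> sw.boundary = {}" "boundary \<inter> sw.boundary = {}"
      unfolding removed_fibres_eq
      using 4(1) by (auto simp: boundary_def sw.boundary_def mixed_def)
    have "?k \<le> card (?T \<union> boundary)" "?k \<le> card (?T \<union> sw.boundary)"
      using 4 boundary_separation sw.boundary_separation
      by (auto simp: sw_mixed intro!: vertex_connectivity_le_separation)
    then have k: "?k \<le> card ?T + card boundary" "?k \<le> card ?T + card sw.boundary"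
      using card_Un_le order_trans by blast+
    \<comment> \<open>The truncated difference also covers the case of at least \<open>\<kappa>\<close> empty fibres.\<close>
    have "?n * ?k \<le> ?n * card ?T + (?n - 1) * (card boundary + card sw.boundary)"
    proof -
      have "?n * ?k \<le> ?n * (card ?T + (?k - card ?T))"
        by (intro mult_le_mono2) simp
      also have "\<dots> = ?n * card ?T + ?n * (?k - card ?T)"
        by (rule distrib_left)
      also have "?n * (?k - card ?T) \<le> ((?n - 1) * 2) * (?k - card ?T)"
        using card_B by (intro mult_le_mono1) simp
      also have "\<dots> = (?n - 1) * (2 * (?k - card ?T))"
        by simp
      also have "\<dots> \<le> (?n - 1) * (card boundary + card sw.boundary)"
        using k by (intro mult_le_mono2) simp
      finally show ?thesis by simp
    qed
    also have "\<dots> = (\<Sum>v\<in>?T. card (S v)) + ((\<Sum>v\<in>boundary. card (S v)) + (\<Sum>v\<in>sw.boundary. card (S v)))"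
      using 4(1) boundary_loss sw.boundary_loss
      by (simp add: sw_mixed distrib_left boundary_def sw.boundary_def)
    also have "\<dots> = (\<Sum>v\<in>?T \<union> (boundary \<union> sw.boundary). card (S v))"
      using fin disj by (simp add: sum.union_disjoint Int_Un_distrib)
    also have "\<dots> \<le> (\<Sum>v\<in>pverts G. card (S v))"
      using pair_finite_verts by (intro sum_mono2) (auto simp: boundary_def sw.boundary_def)
    finally show ?thesis
      by (simp add: min.coboundedI1)
  qed
qed

end


section \<open>Connectivity of the product with a complete graph\<close>

lemma separation_product_fibred:
  assumes "pair_graph G" "finite (pverts K)" "3 \<le> card (pverts K)"
    and K: "parcs K = {(a, b). a \<in> pverts K \<and> b \<in> pverts K \<and> a \<noteq> b}"
    and sep: "separation (direct_product G K) S X Y"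
  shows "fibred_separation G (pverts K) (\<lambda>u. S `` {u}) (\<lambda>u. X `` {u}) (\<lambda>u. Y `` {u})"
proof -
  interpret pair_graph G by fact
  have verts: "pverts G \<times> pverts K = S \<union> X \<union> Y"
    using sep by (simp add: separation_def direct_product_def)
  show ?thesis
  proof unfold_locales
    show "finite (pverts K)" "3 \<le> card (pverts K)" by fact+
    fix u assume "u \<in> pverts G"
    then show "pverts K = S `` {u} \<union> X `` {u} \<union> Y `` {u}"
      using verts by blast
    show "S `` {u} \<inter> X `` {u} = {} \<and> S `` {u} \<inter> Y `` {u} = {} \<and> X `` {u} \<inter> Y `` {u} = {}"
      using sep by (auto simp: separation_def)
  next
    obtain u a w b where "(u, a) \<in> X" "(w, b) \<in> Y"
      using sep by (auto simp: separation_def)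
    then have "u \<in> pverts G" "a \<in> X `` {u}" "w \<in> pverts G" "b \<in> Y `` {w}"
      using verts by blast+
    then show "\<exists>u\<in>pverts G. X `` {u} \<noteq> {}" "\<exists>u\<in>pverts G. Y `` {u} \<noteq> {}"
      by blast+
  next
    fix u w a b assume "(u, w) \<in> parcs G" "a \<in> X `` {u}" "b \<in> Y `` {w}"
    moreover from this have "((u, a), (w, b)) \<notin> parcs (direct_product G K)"
      using sep by (auto simp: separation_def)
    moreover from calculation have "a \<in> pverts K" "b \<in> pverts K"
      using verts by blast+
    ultimately show "a = b"
      by (auto simp: direct_product_def K)
  qed
qed

theorem theorem1:
  fixes G :: "'a pair_pre_digraph" and K :: "'b pair_pre_digraph" and n :: nat
  assumes "pair_graph G" and "pverts G \<noteq> {}"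
    and "n \<ge> 3" and "complete_digraph n (with_proj K)"
  shows "vertex_connectivity (with_proj (direct_product G K)) =
    min (n * vertex_connectivity (with_proj G)) ((n - 1) * min_degree (with_proj G))"
proof -
  let ?P = "direct_product G K" and ?V = "pverts G" and ?B = "pverts K"
  let ?k = "vertex_connectivity (with_proj G)" and ?d = "min_degree (with_proj G)"
  have K: "finite ?B" "card ?B = n" "parcs K = {(a, b). a \<in> ?B \<and> b \<in> ?B \<and> a \<noteq> b}"
    using assms(4) by (simp_all add: complete_digraph_pair_def)
  then interpret K: pair_graph K
    using assms(4) by (intro pair_graphI_graph) (simp add: complete_digraph_def)
  interpret G: pair_graph G by fact
  interpret P: pair_graph ?P
    using assms(1) K.pair_graph by (rule pair_graph_direct_product)
  have PV: "pverts ?P = ?V \<times> ?B"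
    by (simp add: direct_product_def)
  have "?B \<noteq> {}"
    using K(2) assms(3) by auto
  then have PV_ne: "pverts ?P \<noteq> {}"
    using assms(2) by (simp add: PV)
  show ?thesis
  proof (rule antisym)
    obtain b where b: "b \<in> ?B" using \<open>?B \<noteq> {}\<close> by blast
    have "?B - {b} \<noteq> {}"
      using K(1,2) b assms(3) by (metis card_Diff_singleton card.empty diff_is_0_eq not_numeral_le_zero
        numeral_le_one_iff order_trans semiring_norm(70))
    then obtain b' where b': "b' \<in> ?B" "b' \<noteq> b" by blast
    have "vertex_connectivity (with_proj ?P) \<le> n * ?k"
      using assms(2)
    proof (cases rule: G.vertex_connectivity_attained)
      case (1 S X Y)
      then have "separation ?P (S \<times> ?B) (X \<times> ?B) (Y \<times> ?B)"
        using \<open>?B \<noteq> {}\<close> by (auto simp: separation_def direct_product_def)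
      from P.vertex_connectivity_le_separation[OF this] show ?thesis
        by (simp add: 1 card_cartesian_product K mult.commute)
    next
      case (2 x)
      \<comment> \<open>The fibre over the only remaining vertex is edgeless, so any of its vertices is isolated.\<close>
      have "separation ?P ((?V - {x}) \<times> ?B) {(x, b)} ({x} \<times> (?B - {b}))"
        using 2(1) b b' by (auto simp: separation_def direct_product_def dest: G.no_loops')
      from P.vertex_connectivity_le_separation[OF this] show ?thesis
        by (simp add: 2 card_cartesian_product K mult.commute)
    qed
    moreover have "vertex_connectivity (with_proj ?P) \<le> (n - 1) * ?d"
    proof -
      obtain u where u: "u \<in> ?V" "?d = card (parcs G `` {u})"
        using assms(2) by (rule G.min_degree_attained)
      \<comment> \<open>This isolates \<open>(u, b)\<close>, while \<open>(u, b')\<close> stays because \<open>G\<close> has no loops.\<close>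
      let ?S = "(parcs G `` {u}) \<times> (?B - {b})"
      have "separation ?P ?S {(u, b)} (?V \<times> ?B - ?S - {(u, b)})"
        unfolding separation_def
      proof (intro conjI)
        have "(u, b') \<in> ?V \<times> ?B - ?S - {(u, b)}"
          using u(1) b' by (auto dest: G.no_loops')
        then show "?V \<times> ?B - ?S - {(u, b)} \<noteq> {}" by blast
      qed (use u(1) b G.neighbours_subset[of u] in \<open>auto simp: direct_product_def K(3)\<close>)
      from P.vertex_connectivity_le_separation[OF this] show ?thesis
        using b by (simp add: u(2) card_cartesian_product K mult.commute)
    qed
    ultimately show "vertex_connectivity (with_proj ?P) \<le> min (n * ?k) ((n - 1) * ?d)"
      by simp
  next
    show "min (n * ?k) ((n - 1) * ?d) \<le> vertex_connectivity (with_proj ?P)"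
      using PV_ne
    proof (cases rule: P.vertex_connectivity_attained)
      case (1 S X Y)
      interpret fibred_separation G ?B "\<lambda>u. S `` {u}" "\<lambda>u. X `` {u}" "\<lambda>u. Y `` {u}"
        using assms(1) K assms(3) 1(1) by (intro separation_product_fibred) auto
      have sub: "S \<subseteq> ?V \<times> ?B"
        using 1(1) PV by (auto simp: separation_def)
      then have "S = Sigma ?V (\<lambda>u. S `` {u})"
        by auto
      moreover have "card (Sigma ?V (\<lambda>u. S `` {u})) = (\<Sum>u\<in>?V. card (S `` {u}))"
      proof (rule card_SigmaI)
        show "finite ?V" by (rule G.pair_finite_verts)
        have "S `` {u} \<subseteq> ?B" for u using sub by auto
        then show "\<forall>u\<in>?V. finite (S `` {u})" using K(1) finite_subset by blast
      qed
      ultimately have "card S = (\<Sum>u\<in>?V. card (S `` {u}))"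
        by metis
      then show ?thesis
        using lower_bound K(2) 1(2) by simp
    next
      case (2 x)
      \<comment> \<open>All fibres over the neighbours of \<open>u\<close> are removed completely.\<close>
      then obtain u b where ub: "x = (u, b)" "u \<in> ?V" "b \<in> ?B"
        using PV by auto
      have "(n - 1) * ?d \<le> n * card (parcs G `` {u})"
        using G.min_degree_le[OF ub(2)] by (intro mult_le_mono) auto
      also have "\<dots> = card ((parcs G `` {u}) \<times> ?B)"
        by (simp add: card_cartesian_product K mult.commute)
      also have "\<dots> \<le> card (pverts ?P - {x})"
        using G.neighbours_subset[of u] P.pair_finite_verts
        by (intro card_mono) (auto simp: PV ub dest: G.no_loops')
      finally show ?thesis
        by (simp add: 2(2) min.coboundedI2)
    qed
  qed
qed

end
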